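(* Let $T\ge 1$, $\bar x\in\mathbb{R}^{n_{\mathrm x}}$, let $f:\mathbb{R}^{n_{\mathrm x}}\times\mathbb{R}^{n_{\mathrm u}}\to\mathbb{R}^{n_{\mathrm x}}$ be twice continuously differentiable, let $\mathbb{P}=\{(x,u)\in\mathbb{R}^{n_{\mathrm x}}\times\mathbb{R}^{n_{\mathrm u}} : c_i^\top (x,u)+b_i\le 0,\ i=0,\dots,I-1\}$ be a compact polytope with $c_i\in\mathbb{R}^{n_{\mathrm x}+n_{\mathrm u}}$, $b_i\in\mathbb{R}$, and let $\mathbb{W}=\{Ed : d\in\mathbb{R}^{n_{\mathrm w}},\ \|d\|_\infty\le 1\}$ with $E\in\mathbb{R}^{n_{\mathrm x}\times n_{\mathrm w}}$. Let $\mu=\mathrm{diag}(\mu_1,\dots,\mu_{n_{\mathrm x}})$ be the curvature matrix of $f$ on $\mathbb{P}$ defined in the context. Suppose that there exist $\mathbf z=(z_1,\dots,z_T)$ with $z_k\in\mathbb{R}^{n_{\mathrm x}}$, $v_0\in\mathbb{R}^{n_{\mathrm u}}$, $\mathbf v=(v_1,\dots,v_T)$ with $v_k\in\mathbb{R}^{n_{\mathrm u}}$, $\Phi_{\mathrm x}\in\mathcal{L}^{T,n_{\mathrm x}\times n_{\mathrm x}}$, $\Phi_{\mathrm u}\in\mathcal{L}^{T,n_{\mathrm u}\times n_{\mathrm x}}$ and $\boldsymbol\tau=(\tau_0,\dots,\tau_{T-1})\in\mathbb{R}^T$ such that, with $z_0=\bar x$ and $\Phi^{k,j}:=\begin{bmatrix}\Phi_{\mathrm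 x}^{k,j}\\ \Phi_{\mathrm u}^{k,j}\end{bmatrix}$: 1. $\big[\,\mathcal I-\mathcal Z\mathcal A(\mathbf z,\mathbf v)\quad -\mathcal Z\mathcal B(\mathbf z,\mathbf v)\,\big]\begin{bmatrix}\Phi_{\mathrm x}\\ \Phi_{\mathrm u}\end{bmatrix}=\mathcal I$; 2. $z_{k+1}=f(z_k,v_k)$ for $k=0,\dots,T-1$; 3. $\displaystyle\sum_{j=0}^{k-1}\big\|c_i^\top\Phi^{k-1,j}[E,\ \tau_{k-1-j}^2\mu]\big\|_1+c_i^\top(z_k,v_k)+b_i\le 0$ for $k=0,\dots,T$ and $i=0,\dots,I-1$; 4. $\displaystyle\sum_{j=0}^{k-1}\big\|\Phi^{k-1,j}[E,\ \tau_{k-1-j}^2\mu]\big\|_\infty\le\tau_k$ for $k=0,\dots,T-1$. Then the affine error feedback $u_0=v_0$, $\mathbf u=\mathbf v+\mathcal K(\mathbf x-\mathbf z)$ with $\mathcal K=\Phi_{\mathrm u}\Phi_{\mathrm x}^{-1}$, where $\mathbf x=(x_1,\dots,x_T)$ and $\mathbf u=(u_1,\dots,u_T)$, is a causal policy that robustly satisfies the constraints. That is, for every disturbance sequence $w_0,\dots,w_{T-1}\in\mathbb{W}$, the closed-loop trajectory given by $x_0=\bar x$, $x_{k+1}=f(x_k,u_k)+w_k$ $(k=0,\dots,T-1)$ under this feedback satisfies $(x_k,u_k)\in\mathbb{P}$ for all $k=0,\dots,T$.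
   Context: Notation. $(a,b)$ denotes the stacked column vector (or stacked matrix) $[a^\top\ b^\top]^\top$. Empty sums are $0$. For a matrix $M$, $\|M\|_\infty:=\max_{\|d\|_\infty\le1}\|Md\|_\infty$ is the induced $\infty$-norm; for a (row) vector, $\|\cdot\|_1$ is the sum of absolute values of its entries. $\mathcal I$ is an identity matrix of appropriate size. $\mathcal{L}^{T,p\times q}$ is the set of block lower-triangular matrices with $T\times T$ blocks of size $p\times q$, with blocks indexed as follows: for rows $i=0,\dots,T-1$, the block in block-row $i$ and block-column $i-j$ (columns numbered from $0$) is denoted $M^{i,j}$, $0\le j\le i$, and all blocks above the block diagonal vanish. Thus block-row $i$ is $[M^{i,i}\ M^{i,i-1}\ \cdots\ M^{i,0}\ 0\cdots 0]$. $\mathcal Z\in\mathcal{L}^{T,n_{\mathrm x}\times n_{\mathrm x}}$ is the block-lower shift matrix: identity blocks on the first block sub-diagonal, zero blocks elsewhere. Jacobians: $A(z,v):=\frac{\partial f}{\partial x}\big|_{(x,u)=(z,v)}$, $B(z,v):=\frac{\partial f}{\partial u}\big|_{(x,u)=(z,v)}$; $A_k:=A(z_k,v_k)$, $B_k:=B(z_k,v_k)$; $\mathcal A(\mathbf z,\mathbf v):=\mathrm{blkdiag}(A_1,\dots,A_{T-1},0_{n_{\mathrm x},n_{\mathrm x}})$ and $\mathcal B(\mathbf z,\mathbf v):=\mathrm{blkdiag}(B_1,\dots,B_{T-1},0_{n_{\mathrm x},n_{\mathrm u}})$. Curvature constants: for $i=1,\dots,n_{\mathrm x}$, let $H_i(\xi)\in\mathbb{R}^{(n_{\mathrm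 x}+n_{\mathrm u})\times(n_{\mathrm x}+n_{\mathrm u})}$ be the Hessian of the $i$-th component $f_i$ with respect to $(x,u)$, evaluated at $\xi$, and set $\mu_i:=\frac12\max_{\xi\in\mathbb{P},\ \|h\|_\infty\le1}|h^\top H_i(\xi)h|$. A policy is causal if $u_k$ depends only on $x_0,\dots,x_k$. *)

theory Defs
  imports "HOL-Analysis.Analysis"
begin

section \<open>Stacking, norms, derivatives\<close>

text \<open>For element type \<^typ>\<open>real\<close> this is the stacked vector \<open>(a, b)\<close>; for element type
  \<^typ>\<open>real ^ 'c\<close> (rows) it is the vertically stacked matrix.\<close>

definition stack :: "'a ^ 'm \<Rightarrow> 'a ^ 'n \<Rightarrow> 'a ^ ('m + 'n)" where
  "stack a b = (\<chi> s. case s of Inl i \<Rightarrow> a $ i | Inr j \<Rightarrow> b $ j)"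

definition unstack :: "'a ^ ('m + 'n) \<Rightarrow> ('a ^ 'm) \<times> ('a ^ 'n)" where
  "unstack y = ((\<chi> i. y $ Inl i), (\<chi> j. y $ Inr j))"

definition hcat :: "'a ^ 'm ^ 'r \<Rightarrow> 'a ^ 'n ^ 'r \<Rightarrow> 'a ^ ('m + 'n) ^ 'r" where
  "hcat M N = (\<chi> i. stack (M $ i) (N $ i))"

definition diag_mat :: "('n \<Rightarrow> real) \<Rightarrow> real ^ 'n ^ 'n" where
  "diag_mat d = (\<chi> i j. if i = j then d i else 0)"

definition norm_one :: "real ^ 'n \<Rightarrow> real" where
  "norm_one r = (\<Sum>i\<in>UNIV. \<bar>r $ i\<bar>)"

definition mat_infnorm :: "real ^ 'n ^ 'm \<Rightarrow> real" where
  "mat_infnorm M = Sup {infnorm (M *v d) | d. infnorm d \<le> 1}"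

definition twice_continuously_differentiable ::
  "('a::real_normed_vector \<Rightarrow> 'b::real_normed_vector) \<Rightarrow> bool" where
  "twice_continuously_differentiable f \<longleftrightarrow>
     (\<exists>f' :: 'a \<Rightarrow> ('a \<Rightarrow>\<^sub>L 'b). \<exists>f'' :: 'a \<Rightarrow> ('a \<Rightarrow>\<^sub>L ('a \<Rightarrow>\<^sub>L 'b)).
        (\<forall>x. (f has_derivative blinfun_apply (f' x)) (at x)) \<and>
        (\<forall>x. (f' has_derivative blinfun_apply (f'' x)) (at x)) \<and>
        continuous_on UNIV f'')"

definition jac_x :: "((real ^ 'x) \<times> (real ^ 'u) \<Rightarrow> real ^ 'x) \<Rightarrow> real ^ 'x \<Rightarrow> real ^ 'u \<Rightarrow> real ^ 'x ^ 'x" where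
  "jac_x f z v = jacobian (\<lambda>x. f (x, v)) (at z)"

definition jac_u :: "((real ^ 'x) \<times> (real ^ 'u) \<Rightarrow> real ^ 'x) \<Rightarrow> real ^ 'x \<Rightarrow> real ^ 'u \<Rightarrow> real ^ 'u ^ 'x" where
  "jac_u f z v = jacobian (\<lambda>u. f (z, u)) (at v)"

definition gradient :: "(real ^ 'n \<Rightarrow> real) \<Rightarrow> real ^ 'n \<Rightarrow> real ^ 'n" where
  "gradient g y = (\<chi> j. frechet_derivative g (at y) (axis j 1))"

definition hessian :: "(real ^ 'n \<Rightarrow> real) \<Rightarrow> real ^ 'n \<Rightarrow> real ^ 'n ^ 'n" where
  "hessian g y = jacobian (gradient g) (at y)"


section \<open>Constraints, disturbances, curvature\<close>

definition polytope_set ::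
  "nat \<Rightarrow> (nat \<Rightarrow> real ^ ('x + 'u)) \<Rightarrow> (nat \<Rightarrow> real) \<Rightarrow> ((real ^ 'x) \<times> (real ^ 'u)) set" where
  "polytope_set m c b = {(x, u). \<forall>i<m. c i \<bullet> stack x u + b i \<le> 0}"

definition disturbance_set :: "real ^ 'w ^ 'x \<Rightarrow> (real ^ 'x) set" where
  "disturbance_set E = {E *v d | d. infnorm d \<le> 1}"

text \<open>The supremum is a maximum when \<open>f\<close> is twice continuously differentiable and \<open>P\<close> is compact
  and nonempty; for empty \<open>P\<close> the value is unspecified.\<close>

definition curvature ::
  "((real ^ 'x) \<times> (real ^ 'u) \<Rightarrow> real ^ 'x) \<Rightarrow> ((real ^ 'x) \<times> (real ^ 'u)) set \<Rightarrow> 'x \<Rightarrow> real" where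
  "curvature f P i = 1/2 * Sup {\<bar>h \<bullet> (hessian (\<lambda>y. f (unstack y) $ i) (stack x u) *v h)\<bar> | x u h.
     (x, u) \<in> P \<and> infnorm h \<le> 1}"

definition curvature_matrix ::
  "((real ^ 'x) \<times> (real ^ 'u) \<Rightarrow> real ^ 'x) \<Rightarrow> ((real ^ 'x) \<times> (real ^ 'u)) set \<Rightarrow> real ^ 'x ^ 'x" where
  "curvature_matrix f P = diag_mat (curvature f P)"


section \<open>Block matrices\<close>

text \<open>A matrix with \<open>T \<times> T\<close> blocks of size \<open>p \<times> q\<close> is a function \<open>M\<close> taking a block-row and a
  block-column index, both below \<open>T\<close>, to the block; values at other indices are irrelevant.\<close>

type_synonym ('p, 'q) blocks = "nat \<Rightarrow> nat \<Rightarrow> real ^ 'q ^ 'p"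

definition blk_eq :: "nat \<Rightarrow> ('p::finite, 'q::finite) blocks \<Rightarrow> ('p::finite, 'q::finite) blocks \<Rightarrow> bool" where
  "blk_eq T M N \<longleftrightarrow> (\<forall>i<T. \<forall>j<T. M i j = N i j)"

definition blk_add :: "('p::finite, 'q::finite) blocks \<Rightarrow> ('p::finite, 'q::finite) blocks \<Rightarrow> ('p::finite, 'q::finite) blocks" where
  "blk_add M N = (\<lambda>i j. M i j + N i j)"

definition blk_minus :: "('p::finite, 'q::finite) blocks \<Rightarrow> ('p::finite, 'q::finite) blocks" where
  "blk_minus M = (\<lambda>i j. - M i j)"

definition blk_mult :: "nat \<Rightarrow> ('p::finite, 'q::finite) blocks \<Rightarrow> ('q::finite, 'r::finite) blocks \<Rightarrow> ('p::finite, 'r::finite) blocks" where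
  "blk_mult T M N = (\<lambda>i j. \<Sum>l<T. M i l ** N l j)"

definition blk_diag :: "(nat \<Rightarrow> real ^ 'q ^ 'p) \<Rightarrow> ('p::finite, 'q::finite) blocks" where
  "blk_diag D = (\<lambda>i j. if i = j then D i else 0)"

definition blk_one :: "('p::finite, 'p::finite) blocks" where
  "blk_one = blk_diag (\<lambda>i. mat 1)"

definition blk_shift :: "('p::finite, 'p::finite) blocks" where
  "blk_shift = (\<lambda>i j. if i = Suc j then mat 1 else 0)"

definition blk_inverts :: "nat \<Rightarrow> ('p::finite, 'p::finite) blocks \<Rightarrow> ('p::finite, 'p::finite) blocks \<Rightarrow> bool" where
  "blk_inverts T M N \<longleftrightarrow> blk_eq T (blk_mult T M N) blk_one \<and> blk_eq T (blk_mult T N M) blk_one"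

definition blk_invertible :: "nat \<Rightarrow> ('p::finite, 'p::finite) blocks \<Rightarrow> bool" where
  "blk_invertible T M \<longleftrightarrow> (\<exists>N. blk_inverts T M N)"

definition blk_inv :: "nat \<Rightarrow> ('p::finite, 'p::finite) blocks \<Rightarrow> ('p::finite, 'p::finite) blocks" where
  "blk_inv T M = (SOME N. blk_inverts T M N)"

definition blk_lower :: "nat \<Rightarrow> ('p::finite, 'q::finite) blocks set" where
  "blk_lower T = {M. \<forall>i<T. \<forall>j<T. i < j \<longrightarrow> M i j = 0}"

text \<open>The block \<open>M\<^sup>i\<^sup>,\<^sup>j\<close> of a block-lower-triangular matrix: \<open>j\<close> counts block columns leftwards from
  the diagonal.\<close>

definition sub_block :: "('p::finite, 'q::finite) blocks \<Rightarrow> nat \<Rightarrow> nat \<Rightarrow> real ^ 'q ^ 'p" where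
  "sub_block M i j = M i (i - j)"

definition stacked_sub_block ::
  "('p::finite, 'q::finite) blocks \<Rightarrow> ('r::finite, 'q::finite) blocks \<Rightarrow> nat \<Rightarrow> nat \<Rightarrow> real ^ 'q ^ ('p + 'r)" where
  "stacked_sub_block M N i j = stack (sub_block M i j) (sub_block N i j)"

text \<open>Block row \<open>i\<close> belongs to time \<open>i + 1\<close>.\<close>

definition blk_A ::
  "nat \<Rightarrow> ((real ^ 'x) \<times> (real ^ 'u) \<Rightarrow> real ^ 'x) \<Rightarrow> (nat \<Rightarrow> real ^ 'x) \<Rightarrow> (nat \<Rightarrow> real ^ 'u) \<Rightarrow> ('x::finite, 'x::finite) blocks" where
  "blk_A T f z v = blk_diag (\<lambda>i. if Suc i < T then jac_x f (z (Suc i)) (v (Suc i)) else 0)"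

definition blk_B ::
  "nat \<Rightarrow> ((real ^ 'x) \<times> (real ^ 'u) \<Rightarrow> real ^ 'x) \<Rightarrow> (nat \<Rightarrow> real ^ 'x) \<Rightarrow> (nat \<Rightarrow> real ^ 'u) \<Rightarrow> ('x::finite, 'u::finite) blocks" where
  "blk_B T f z v = blk_diag (\<lambda>i. if Suc i < T then jac_u f (z (Suc i)) (v (Suc i)) else 0)"

text \<open>The product of the block row \<open>[I - Z A, - Z B]\<close> with the block column \<open>(\<Phi>\<^sub>x, \<Phi>\<^sub>u)\<close>.\<close>

definition sls_lhs ::
  "nat \<Rightarrow> ((real ^ 'x) \<times> (real ^ 'u) \<Rightarrow> real ^ 'x) \<Rightarrow> (nat \<Rightarrow> real ^ 'x) \<Rightarrow> (nat \<Rightarrow> real ^ 'u) \<Rightarrow>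
   ('x::finite, 'x::finite) blocks \<Rightarrow> ('u::finite, 'x::finite) blocks \<Rightarrow> ('x::finite, 'x::finite) blocks" where
  "sls_lhs T f z v \<Phi>x \<Phi>u =
     blk_add
       (blk_mult T (blk_add blk_one (blk_minus (blk_mult T blk_shift (blk_A T f z v)))) \<Phi>x)
       (blk_mult T (blk_minus (blk_mult T blk_shift (blk_B T f z v))) \<Phi>u)"


section \<open>Policies and closed loop\<close>

definition feedback_gain :: "nat \<Rightarrow> ('x::finite, 'x::finite) blocks \<Rightarrow> ('u::finite, 'x::finite) blocks \<Rightarrow> ('u::finite, 'x::finite) blocks" where
  "feedback_gain T \<Phi>x \<Phi>u = blk_mult T \<Phi>u (blk_inv T \<Phi>x)"

text \<open>A policy maps a whole state trajectory to an input trajectory, so that causality is a property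
  to be shown.\<close>

type_synonym ('x, 'u) policy = "(nat \<Rightarrow> real ^ 'x) \<Rightarrow> nat \<Rightarrow> real ^ 'u"

definition error_feedback ::
  "nat \<Rightarrow> ('u::finite, 'x::finite) blocks \<Rightarrow> (nat \<Rightarrow> real ^ 'x) \<Rightarrow> (nat \<Rightarrow> real ^ 'u) \<Rightarrow> ('x::finite, 'u::finite) policy" where
  "error_feedback T K z v = (\<lambda>x k. case k of
       0 \<Rightarrow> v 0
     | Suc i \<Rightarrow> v (Suc i) + (\<Sum>j<T. K i j *v (x (Suc j) - z (Suc j))))"

definition causal :: "nat \<Rightarrow> ('x::finite, 'u::finite) policy \<Rightarrow> bool" where
  "causal T \<pi> \<longleftrightarrow> (\<forall>k\<le>T. \<forall>x y. (\<forall>j\<le>k. x j = y j) \<longrightarrow> \<pi> x k = \<pi> y k)"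

definition closed_loop ::
  "nat \<Rightarrow> ((real ^ 'x) \<times> (real ^ 'u) \<Rightarrow> real ^ 'x) \<Rightarrow> ('x::finite, 'u::finite) policy \<Rightarrow> real ^ 'x \<Rightarrow>
   (nat \<Rightarrow> real ^ 'x) \<Rightarrow> (nat \<Rightarrow> real ^ 'x) \<Rightarrow> (nat \<Rightarrow> real ^ 'u) \<Rightarrow> bool" where
  "closed_loop T f \<pi> xbar w x u \<longleftrightarrow>
     x 0 = xbar \<and> (\<forall>k\<le>T. u k = \<pi> x k) \<and> (\<forall>k<T. x (Suc k) = f (x k, u k) + w k)"

end

(* The system level constraint forces Phi_x to be block lower triangular with identity diagonal,
   hence invertible.  In the coordinates y = Phi_x^-1 (x - z) it says that y_k is the disturbance w_k
   plus the remainder of the linearization of f at (z_k, v_k), and the deviation at time k is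
   Phi applied to y_0, ..., y_(k-1).  As long as the trajectory has stayed in P with deviation at
   most tau, Taylor's theorem bounds the remainder by tau^2 mu, so y_l = [E, tau_l^2 mu] d with
   infnorm d <= 1; conditions 3 and 4 are then the Hoelder bounds that continue the induction. *)
theory Submission
  imports Defs
begin

section \<open>Stacked vectors and norms\<close>

lemma unstack_stack [simp]: "unstack (stack a b) = (a, b)"
  by (simp add: unstack_def stack_def vec_eq_iff)

lemma stack_nth [simp]: "stack a b $ Inl i = a $ i" "stack a b $ Inr j = b $ j"
  by (simp_all add: stack_def)

lemma vec_sum_eqI:
  assumes "\<And>i. x $ Inl i = y $ Inl i" "\<And>j. x $ Inr j = y $ Inr j"
  shows "x = y"
  unfolding vec_eq_iff
proof
  fix s show "x $ s = y $ s" using assms by (cases s) auto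
qed

lemma stack_add: "stack (a + a') (b + b') = stack a b + stack a' b'"
  by (rule vec_sum_eqI) simp_all

lemma stack_diff: "stack (a - a') (b - b') = stack a b - (stack a' b' :: 'a::ab_group_add ^ _)"
  by (rule vec_sum_eqI) simp_all

lemma stack_zero: "stack 0 0 = 0"
  by (rule vec_sum_eqI) simp_all

lemma stack_sum: "stack (\<Sum>i\<in>S. a i) (\<Sum>i\<in>S. b i) = (\<Sum>i\<in>S. stack (a i) (b i))"
  by (induction S rule: infinite_finite_induct) (simp_all add: stack_zero stack_add)

lemma linear_unstack: "linear (unstack :: real ^ ('m::finite + 'n::finite) \<Rightarrow> _)"
  by (rule linearI) (simp_all add: unstack_def vec_eq_iff)

lemma sum_UNIV_Plus:
  fixes g :: "'m::finite + 'n::finite \<Rightarrow> 'a::comm_monoid_add"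
  shows "sum g UNIV = (\<Sum>i\<in>UNIV. g (Inl i)) + (\<Sum>j\<in>UNIV. g (Inr j))"
  using sum.Plus[of "UNIV :: 'm set" "UNIV :: 'n set" g] by (simp add: comp_def)

lemma stack_mult_vec:
  fixes M :: "real ^ 'q ^ 'm"
  shows "stack M N *v y = stack (M *v y) (N *v y)"
  by (rule vec_sum_eqI) (simp_all add: matrix_vector_mult_def)

lemma hcat_mult_vec:
  fixes M :: "real ^ 'm ^ 'r"
  shows "hcat M N *v stack a b = M *v a + N *v b"
  by (simp add: vec_eq_iff hcat_def matrix_vector_mult_def sum_UNIV_Plus)

section \<open>Infinity norm, 1-norm and the Hoelder bounds between them\<close>

lemma infnorm_le_iff_cart:
  fixes x :: "real ^ 'n"
  shows "infnorm x \<le> r \<longleftrightarrow> (\<forall>i. \<bar>x $ i\<bar> \<le> r)"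
proof
  assume "infnorm x \<le> r"
  then show "\<forall>i. \<bar>x $ i\<bar> \<le> r" by (meson component_le_infnorm_cart order_trans)
next
  assume "\<forall>i. \<bar>x $ i\<bar> \<le> r"
  then show "infnorm x \<le> r"
    unfolding infnorm_cart by (intro cSup_least) auto
qed

lemma infnorm_stack_le_iff:
  fixes a :: "real ^ 'm" and b :: "real ^ 'n"
  shows "infnorm (stack a b) \<le> r \<longleftrightarrow> infnorm a \<le> r \<and> infnorm b \<le> r"
  unfolding infnorm_le_iff_cart by (metis stack_nth sum.exhaust)

lemma infnorm_sum_le: "infnorm (\<Sum>i\<in>S. g i) \<le> (\<Sum>i\<in>S. infnorm (g i))"
proof (induction S rule: infinite_finite_induct)
  case (insert x F)
  then show ?case using infnorm_triangle[of "g x" "sum g F"] by simp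
qed (simp_all add: infnorm_0)

lemma norm_one_nonneg: "0 \<le> norm_one r"
  by (simp add: norm_one_def sum_nonneg)

text \<open>Hoelder's inequality for the dual pair of 1-norm and infinity norm. It is the source of
  the constraint tightening in condition 3.\<close>

lemma inner_le_norm_one:
  fixes r d :: "real ^ 'n"
  assumes "infnorm d \<le> 1"
  shows "r \<bullet> d \<le> norm_one r"
  unfolding inner_vec_def norm_one_def
proof (rule sum_mono)
  fix i
  have "r $ i * d $ i \<le> \<bar>r $ i\<bar> * \<bar>d $ i\<bar>" by (metis abs_ge_self abs_mult)
  also have "\<dots> \<le> \<bar>r $ i\<bar> * 1"
    using assms by (intro mult_left_mono) (auto simp: infnorm_le_iff_cart)
  finally show "r $ i \<bullet> d $ i \<le> \<bar>r $ i\<bar>" by simp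
qed

lemma infnorm_le_mat_infnorm:
  fixes M :: "real ^ 'n ^ 'm"
  assumes "infnorm d \<le> 1"
  shows "infnorm (M *v d) \<le> mat_infnorm M"
  unfolding mat_infnorm_def
proof (rule cSup_upper)
  show "infnorm (M *v d) \<in> {infnorm (M *v d) |d. infnorm d \<le> 1}" using assms by blast
  \<comment> \<open>Since \<open>mat_infnorm\<close> is a \<open>Sup\<close>, boundedness above has
    to be shown. The sum of all row 1-norms is a crude bound that serves every component at
    once.\<close>
  have "infnorm (M *v e) \<le> (\<Sum>i\<in>UNIV. norm_one (M $ i))" if "infnorm e \<le> 1" for e
    unfolding infnorm_le_iff_cart
  proof
    fix i
    have "(M $ i) \<bullet> e \<le> norm_one (M $ i)" by (rule inner_le_norm_one[OF that])
    moreover have "(M $ i) \<bullet> (- e) \<le> norm_one (M $ i)"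
      by (rule inner_le_norm_one) (simp add: that infnorm_neg)
    ultimately have "\<bar>(M *v e) $ i\<bar> \<le> norm_one (M $ i)"
      by (simp add: matrix_vector_mul_component)
    also have "\<dots> \<le> (\<Sum>i\<in>UNIV. norm_one (M $ i))"
      by (rule member_le_sum) (auto simp: norm_one_nonneg)
    finally show "\<bar>(M *v e) $ i\<bar> \<le> (\<Sum>i\<in>UNIV. norm_one (M $ i))" .
  qed
  then show "bdd_above {infnorm (M *v d) |d. infnorm d \<le> 1}"
    by (auto intro!: bdd_aboveI)
qed

section \<open>Block matrices\<close>

lemma zero_matrix_mult [simp]: "(0 :: real ^ 'a ^ 'b) ** M = 0" "M ** (0 :: real ^ 'a ^ 'b) = 0"
  by (simp_all add: vec_eq_iff matrix_matrix_mult_def)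

lemma matrix_mult_add_left: "(M + N) ** L = M ** L + (N :: real ^ 'a ^ 'b) ** L"
  by (simp add: vec_eq_iff matrix_matrix_mult_def distrib_right sum.distrib)

lemma matrix_mult_sum_left: "(\<Sum>l\<in>S. M l) ** N = (\<Sum>l\<in>S. M l ** (N :: real ^ 'a ^ 'b))"
  by (induction S rule: infinite_finite_induct) (simp_all add: matrix_mult_add_left)

lemma matrix_mult_sum_right: "M ** (\<Sum>l\<in>S. N l) = (\<Sum>l\<in>S. (M :: real ^ 'a ^ 'b) ** N l)"
  by (induction S rule: infinite_finite_induct) (simp_all add: matrix_add_ldistrib)

lemma matrix_vector_mult_sum_left: "(\<Sum>l\<in>S. M l) *v x = (\<Sum>l\<in>S. M l *v (x :: real ^ 'a))"
  by (induction S rule: infinite_finite_induct) (simp_all add: matrix_vector_mult_add_rdistrib)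

lemma matrix_vector_mult_sum_right: "M *v (\<Sum>l\<in>S. x l) = (\<Sum>l\<in>S. (M :: real ^ 'a ^ 'b) *v x l)"
  by (rule linear_sum[OF matrix_vector_mul_linear, unfolded comp_def])

lemma matrix_mult_minus_left: "(- M) ** N = - ((M :: real ^ 'a ^ 'b) ** N)"
  by (simp add: vec_eq_iff matrix_matrix_mult_def sum_negf)

lemma matrix_mult_diff_left: "(M - N) ** L = M ** L - (N :: real ^ 'a ^ 'b) ** L"
  by (simp add: vec_eq_iff matrix_matrix_mult_def left_diff_distrib sum_subtractf)

lemma blk_mult_assoc: "blk_mult T (blk_mult T L M) N = blk_mult T L (blk_mult T M N)"
proof (intro ext)
  fix i j
  have "(\<Sum>l<T. (\<Sum>k<T. L i k ** M k l) ** N l j) = (\<Sum>l<T. \<Sum>k<T. L i k ** (M k l ** N l j))"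
    by (simp add: matrix_mult_sum_left matrix_mul_assoc)
  also have "\<dots> = (\<Sum>k<T. \<Sum>l<T. L i k ** (M k l ** N l j))" by (rule sum.swap)
  finally show "blk_mult T (blk_mult T L M) N i j = blk_mult T L (blk_mult T M N) i j"
    by (simp add: blk_mult_def matrix_mult_sum_right)
qed

lemma blk_eq_mult:
  assumes "blk_eq T M M'" "blk_eq T N N'"
  shows "blk_eq T (blk_mult T M N) (blk_mult T M' N')"
  using assms by (auto simp: blk_eq_def blk_mult_def intro!: sum.cong)

lemma blk_eq_trans: "blk_eq T L M \<Longrightarrow> blk_eq T M N \<Longrightarrow> blk_eq T L N"
  and blk_eq_sym: "blk_eq T L M \<Longrightarrow> blk_eq T M L"
  and blk_eq_refl: "blk_eq T L L"
  by (auto simp: blk_eq_def)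

lemma blk_one_mult: "blk_eq T (blk_mult T blk_one M) M"
  by (auto simp: blk_eq_def blk_mult_def blk_one_def blk_diag_def if_distrib[of "\<lambda>x. x ** _"]
      sum.delta' cong: if_cong)

lemma blk_mult_one: "blk_eq T (blk_mult T M blk_one) M"
  by (auto simp: blk_eq_def blk_mult_def blk_one_def blk_diag_def if_distrib[of "\<lambda>x. _ ** x"]
      cong: if_cong)

text \<open>With unit diagonal, block row \<open>i\<close> of \<open>M N = 1\<close> expresses
  \<open>N i j\<close> through the blocks \<open>N l j\<close> with \<open>l < i\<close>. To the
  right of the diagonal these vanish by induction and the right-hand side is zero; on the diagonal
  only the identity remains.\<close>

lemma blk_lower_right_inverse:
  assumes low: "M \<in> blk_lower T" and diag: "\<And>i. i < T \<Longrightarrow> M i i = mat 1"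
    and inv: "blk_eq T (blk_mult T M N) blk_one"
  shows "N \<in> blk_lower T" and "\<And>i. i < T \<Longrightarrow> N i i = mat 1"
proof -
  have split: "blk_mult T M N i j = (\<Sum>l<i. M i l ** N l j) + N i j" if "i < T" for i j
  proof -
    have "blk_mult T M N i j = (\<Sum>l<Suc i. M i l ** N l j)"
      unfolding blk_mult_def using that low
      by (intro sum.mono_neutral_right) (auto simp: blk_lower_def)
    then show ?thesis using diag[OF that] by simp
  qed
  have zero: "N i j = 0" if "i < j" "j < T" for i j
    using that
  proof (induction i rule: less_induct)
    case (less i)
    have "(\<Sum>l<i. M i l ** N l j) = 0" using less by (intro sum.neutral) auto
    moreover have "blk_mult T M N i j = 0"
      using inv less.prems by (auto simp: blk_eq_def blk_one_def blk_diag_def)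
    ultimately show ?case using split[of i j] less.prems by simp
  qed
  then show "N \<in> blk_lower T" by (auto simp: blk_lower_def)
  fix i assume i: "i < T"
  have "(\<Sum>l<i. M i l ** N l i) = 0" using zero i by (intro sum.neutral) auto
  moreover have "blk_mult T M N i i = mat 1"
    using inv i by (auto simp: blk_eq_def blk_one_def blk_diag_def)
  ultimately show "N i i = mat 1" using split[OF i, of i] by simp
qed

text \<open>Solves \<open>M N = 1\<close> one block row at a time, which is possible when the
  diagonal blocks of \<open>M\<close> are identities. The equation leaves the simp set afterwards,
  as rewriting with it would not terminate.\<close>

fun forward_subst :: "('p::finite, 'p) blocks \<Rightarrow> nat \<Rightarrow> nat \<Rightarrow> real ^ 'p ^ 'p" where
  "forward_subst M i j = (if i = j then mat 1 else 0) - (\<Sum>l<i. M i l ** forward_subst M l j)"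

declare forward_subst.simps [simp del]

lemma forward_subst_right_inverse:
  assumes low: "M \<in> blk_lower T" and diag: "\<And>i. i < T \<Longrightarrow> M i i = mat 1"
  shows "blk_eq T (blk_mult T M (forward_subst M)) blk_one"
  unfolding blk_eq_def
proof (intro allI impI)
  fix i j assume i: "i < T" and "j < T"
  have "blk_mult T M (forward_subst M) i j = (\<Sum>l<Suc i. M i l ** forward_subst M l j)"
    unfolding blk_mult_def using i low
    by (intro sum.mono_neutral_right) (auto simp: blk_lower_def)
  also have "\<dots> = (\<Sum>l<i. M i l ** forward_subst M l j) + forward_subst M i j"
    using diag[OF i] by simp
  also have "\<dots> = blk_one i j"
    by (simp add: forward_subst.simps[of M i j] blk_one_def blk_diag_def)
  finally show "blk_mult T M (forward_subst M) i j = blk_one i j" .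
qed

text \<open>A right inverse of a unit lower triangular matrix is again unit lower triangular, so it has
  a right inverse itself and is therefore two-sided.\<close>

lemma blk_lower_invertible:
  assumes low: "M \<in> blk_lower T" and diag: "\<And>i. i < T \<Longrightarrow> M i i = mat 1"
  shows "blk_invertible T M"
proof -
  define N where "N = forward_subst M"
  define L where "L = forward_subst N"
  have MN: "blk_eq T (blk_mult T M N) blk_one"
    unfolding N_def by (rule forward_subst_right_inverse[OF assms])
  have NL: "blk_eq T (blk_mult T N L) blk_one"
    unfolding L_def
    by (rule forward_subst_right_inverse) (use blk_lower_right_inverse[OF low diag MN] in auto)
  \<comment> \<open>Cancellation \<open>M = M (N L) = (M N) L = L\<close>, valid up to
    \<open>blk_eq\<close>; hence \<open>N L = 1\<close> turns into \<open>N M = 1\<close>.\<close>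
  have "blk_eq T M (blk_mult T M (blk_mult T N L))"
    by (meson NL blk_eq_mult blk_eq_refl blk_eq_sym blk_eq_trans blk_mult_one)
  moreover have "blk_eq T (blk_mult T M (blk_mult T N L)) L"
    unfolding blk_mult_assoc[symmetric]
    by (meson MN blk_eq_mult blk_eq_refl blk_eq_trans blk_one_mult)
  ultimately have "blk_eq T M L" by (rule blk_eq_trans)
  then have "blk_eq T (blk_mult T N M) blk_one"
    by (meson NL blk_eq_mult blk_eq_refl blk_eq_trans)
  with MN show ?thesis unfolding blk_invertible_def blk_inverts_def by blast
qed

lemma blk_inverts_blk_inv: "blk_invertible T M \<Longrightarrow> blk_inverts T M (blk_inv T M)"
  unfolding blk_invertible_def blk_inv_def by (rule someI_ex[of "blk_inverts T M"])

lemma blk_lower_mult: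
  assumes "M \<in> blk_lower T" "N \<in> blk_lower T"
  shows "blk_mult T M N \<in> blk_lower T"
  unfolding blk_lower_def mem_Collect_eq
proof (intro allI impI)
  fix i j assume ij: "i < T" "j < T" "i < j"
  have "M i l ** N l j = 0" if "l < T" for l
    using assms ij that by (cases "i < l") (auto simp: blk_lower_def)
  then show "blk_mult T M N i j = 0" by (simp add: blk_mult_def)
qed

text \<open>Associativity of a block product with a block vector. It lets the feedback
  \<open>K (x - z)\<close> be read as \<open>\<Phi>u\<close> applied to the coordinates
  \<open>y\<close>.\<close>

lemma blk_mult_vec:
  "(\<Sum>j<T. blk_mult T M N i j *v x j) = (\<Sum>l<T. M i l *v (\<Sum>j<T. N l j *v x j))"
proof -
  have "(\<Sum>j<T. blk_mult T M N i j *v x j) = (\<Sum>j<T. \<Sum>l<T. M i l *v (N l j *v x j))"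
    by (simp add: blk_mult_def matrix_vector_mult_sum_left matrix_vector_mul_assoc)
  also have "\<dots> = (\<Sum>l<T. \<Sum>j<T. M i l *v (N l j *v x j))" by (rule sum.swap)
  finally show ?thesis by (simp add: matrix_vector_mult_sum_right)
qed

section \<open>The block shift and the recursion encoded by the system level constraint\<close>

lemma blk_shift_mult_diag:
  assumes "l < T"
  shows "blk_mult T blk_shift (blk_diag D) i l = (if i = Suc l then D l else 0)"
proof -
  have "blk_mult T blk_shift (blk_diag D) i l
      = (\<Sum>k<T. if k = l then (if i = Suc l then D l else 0) else 0)"
    unfolding blk_mult_def blk_shift_def blk_diag_def by (intro sum.cong) auto
  then show ?thesis using assms by (simp add: sum.delta')
qed

lemma blk_shift_diag_mult:
  assumes "i < T"
  shows "blk_mult T (blk_mult T blk_shift (blk_diag D)) N i j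
       = (case i of 0 \<Rightarrow> 0 | Suc l \<Rightarrow> D l ** N l j)"
proof -
  have "blk_mult T (blk_mult T blk_shift (blk_diag D)) N i j
      = (\<Sum>l<T. if i = Suc l then D l ** N l j else 0)"
    unfolding blk_mult_def[of T _ N] by (intro sum.cong) (auto simp: blk_shift_mult_diag)
  also have "\<dots> = (case i of 0 \<Rightarrow> 0 | Suc l \<Rightarrow> D l ** N l j)"
    using assms by (cases i) (auto simp: sum.delta')
  finally show ?thesis .
qed

text \<open>The shift moves diagonal block \<open>l\<close> of \<open>blk_A\<close> and
  \<open>blk_B\<close>, which holds the Jacobian at time \<open>l + 1\<close>, to block row
  \<open>l + 1\<close>. So row \<open>i\<close> sees the Jacobians at time \<open>i\<close>, and the
  zero block at the end is shifted out of the matrix.\<close>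

lemma sls_recursion:
  assumes sls: "blk_eq T (sls_lhs T f z v \<Phi>x \<Phi>u) blk_one" and i: "i < T" and j: "j < T"
  shows "\<Phi>x i j = blk_one i j + (case i of 0 \<Rightarrow> 0 | Suc l \<Rightarrow>
           jac_x f (z i) (v i) ** \<Phi>x l j + jac_u f (z i) (v i) ** \<Phi>u l j)"
proof -
  let ?ZA = "blk_mult T blk_shift (blk_A T f z v)" and ?ZB = "blk_mult T blk_shift (blk_B T f z v)"
  have "blk_mult T (blk_add blk_one (blk_minus ?ZA)) \<Phi>x i j
      = blk_mult T blk_one \<Phi>x i j - blk_mult T ?ZA \<Phi>x i j"
    by (simp add: blk_mult_def blk_add_def blk_minus_def matrix_mult_diff_left sum_subtractf)
  moreover have "blk_mult T blk_one \<Phi>x i j = \<Phi>x i j"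
    using blk_one_mult[of T \<Phi>x] i j by (simp add: blk_eq_def)
  moreover have "blk_mult T (blk_minus ?ZB) \<Phi>u i j = - blk_mult T ?ZB \<Phi>u i j"
    by (simp add: blk_mult_def[of T _ \<Phi>u] blk_minus_def matrix_mult_minus_left sum_negf)
  moreover have "blk_mult T (blk_add blk_one (blk_minus ?ZA)) \<Phi>x i j + blk_mult T (blk_minus ?ZB) \<Phi>u i j
      = blk_one i j"
    using sls i j unfolding blk_eq_def sls_lhs_def by (simp add: blk_add_def[of "blk_mult T _ _"])
  ultimately have "blk_one i j = \<Phi>x i j - blk_mult T ?ZA \<Phi>x i j - blk_mult T ?ZB \<Phi>u i j"
    by simp
  then have "\<Phi>x i j = blk_one i j + blk_mult T ?ZA \<Phi>x i j + blk_mult T ?ZB \<Phi>u i j"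
    by simp
  then show ?thesis
    unfolding blk_A_def blk_B_def blk_shift_diag_mult[OF i] using i
    by (cases i) (auto simp: add.assoc)
qed

section \<open>Second-order expansion\<close>

lemma jacobian_mult_vec:
  fixes F :: "real ^ 'n \<Rightarrow> real ^ 'm"
  assumes "(F has_derivative F') (at x)"
  shows "jacobian F (at x) *v h = F' h"
  using matrix_vector_mul(3)[OF has_derivative_bounded_linear[OF assms]]
  by (simp add: jacobian_def frechet_derivative_at[OF assms, symmetric] fun_eq_iff)

text \<open>The chain rule for the embeddings \<open>x -> (x, v)\<close> and
  \<open>u -> (z, u)\<close> identifies the two Jacobians with restrictions of the total derivative;
  linearity adds them up.\<close>

lemma jac_partial_derivatives:
  fixes f :: "(real ^ 'x) \<times> (real ^ 'u) \<Rightarrow> real ^ 'x"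
  assumes f': "(f has_derivative f') (at (z, v))"
  shows "jac_x f z v *v a + jac_u f z v *v b = f' (a, b)"
proof -
  have lin: "linear f'" using f' by (rule has_derivative_linear)
  have "((\<lambda>x. (x, v)) has_derivative (\<lambda>a. (a, 0))) (at z)"
    by (auto intro!: derivative_eq_intros)
  then have X: "((\<lambda>x. f (x, v)) has_derivative (\<lambda>a. f' (a, 0))) (at z)"
    using diff_chain_at[of "\<lambda>x. (x, v)" _ z f f'] f' by (simp add: comp_def)
  have "((\<lambda>u. (z, u)) has_derivative (\<lambda>b. (0, b))) (at v)"
    by (auto intro!: derivative_eq_intros)
  then have U: "((\<lambda>u. f (z, u)) has_derivative (\<lambda>b. f' (0, b))) (at v)"
    using diff_chain_at[of "\<lambda>u. (z, u)" _ v f f'] f' by (simp add: comp_def)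
  have "jac_x f z v *v a = f' (a, 0)"
    unfolding jac_x_def by (rule jacobian_mult_vec[OF X])
  moreover have "jac_u f z v *v b = f' (0, b)"
    unfolding jac_u_def by (rule jacobian_mult_vec[OF U])
  ultimately show ?thesis using linear_add[OF lin, of "(a, 0)" "(0, b)"] by simp
qed

lemma inner_linear_axis:
  fixes L :: "real ^ 'n \<Rightarrow> real"
  assumes "linear L"
  shows "h \<bullet> (\<chi> j. L (axis j 1)) = L h"
proof -
  have "L h = L (\<Sum>j\<in>UNIV. h $ j *\<^sub>R axis j 1)"
    using basis_expansion[of h] by (simp add: scalar_mult_eq_scaleR)
  also have "\<dots> = (\<Sum>j\<in>UNIV. h $ j * L (axis j 1))"
    by (simp add: linear_sum[OF assms] linear_cmul[OF assms] comp_def)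
  finally show ?thesis by (simp add: inner_vec_def)
qed

text \<open>Fixes the two derivatives whose existence
  \<open>twice_continuously_differentiable\<close> asserts, so that the estimates can refer to them
  by name.\<close>

locale C2_map =
  fixes f :: "(real ^ 'x) \<times> (real ^ 'u) \<Rightarrow> real ^ 'x"
    and f' :: "(real ^ 'x) \<times> (real ^ 'u) \<Rightarrow> ((real ^ 'x) \<times> (real ^ 'u)) \<Rightarrow>\<^sub>L (real ^ 'x)"
    and f'' :: "(real ^ 'x) \<times> (real ^ 'u) \<Rightarrow>
      ((real ^ 'x) \<times> (real ^ 'u)) \<Rightarrow>\<^sub>L (((real ^ 'x) \<times> (real ^ 'u)) \<Rightarrow>\<^sub>L (real ^ 'x))"
  assumes f': "\<And>p. (f has_derivative blinfun_apply (f' p)) (at p)"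
    and f'': "\<And>p. (f' has_derivative blinfun_apply (f'' p)) (at p)"
    and cont_f'': "continuous_on UNIV f''"
begin

lemma f'_apply_has_derivative:
  "((\<lambda>p. f' p k $ i) has_derivative (\<lambda>h. f'' p h k $ i)) (at p)"
proof -
  have "bounded_linear (\<lambda>A. blinfun_apply A k $ i)"
    by (intro bounded_linear_compose[OF bounded_linear_vec_nth] blinfun.bounded_linear_left)
  then show ?thesis by (rule bounded_linear.has_derivative[OF _ f''])
qed

lemma unstack_has_derivative: "(unstack has_derivative unstack) (at (y :: real ^ ('x + 'u)))"
  using linear_unstack by (intro bounded_linear_imp_has_derivative) (simp add: linear_conv_bounded_linear)

text \<open>\<open>unstack\<close> is linear, hence its own derivative, and differentiating twice
  through it only inserts it into the arguments. The Hessian times \<open>h\<close> is the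
  derivative of the gradient in direction \<open>h\<close>, with entries \<open>f''\<close> at
  \<open>h\<close> and the axes; pairing with \<open>h\<close> fills the second slot.\<close>

lemma hessian_quadratic_form:
  "h \<bullet> (hessian (\<lambda>y. f (unstack y) $ i) y *v h) = f'' (unstack y) (unstack h) (unstack h) $ i"
proof -
  have "((\<lambda>y. f (unstack y) $ i) has_derivative (\<lambda>h. f' (unstack y) (unstack h) $ i)) (at y)" for y
    using bounded_linear.has_derivative[OF bounded_linear_vec_nth
        diff_chain_at[OF unstack_has_derivative f'], of i] by (simp add: comp_def)
  then have "frechet_derivative (\<lambda>y. f (unstack y) $ i) (at y) = (\<lambda>h. f' (unstack y) (unstack h) $ i)" for y
    by (metis frechet_derivative_at)
  then have grad: "gradient (\<lambda>y. f (unstack y) $ i)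
      = (\<lambda>y. \<chi> j. f' (unstack y) (unstack (axis j 1)) $ i)"
    by (simp add: gradient_def fun_eq_iff)
  have "((\<lambda>y. f' (unstack y) k $ i) has_derivative (\<lambda>h. f'' (unstack y) (unstack h) k $ i)) (at y)" for k
    using diff_chain_at[OF unstack_has_derivative f'_apply_has_derivative] by (simp add: comp_def)
  then have D: "(gradient (\<lambda>y. f (unstack y) $ i) has_derivative
      (\<lambda>h. \<chi> j. f'' (unstack y) (unstack h) (unstack (axis j 1)) $ i)) (at y)"
    unfolding grad
    by (subst has_derivative_componentwise_within)
      (auto simp: Basis_vec_def inner_axis)
  have "hessian (\<lambda>y. f (unstack y) $ i) y *v h
      = (\<chi> j. f'' (unstack y) (unstack h) (unstack (axis j 1)) $ i)"
    unfolding hessian_def by (rule jacobian_mult_vec[OF D])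
  moreover have "linear (\<lambda>k. f'' (unstack y) (unstack h) (unstack k) $ i)"
    by (rule linearI) (simp_all add: linear_add[OF linear_unstack] linear_cmul[OF linear_unstack]
        blinfun.add_right blinfun.scaleR_right)
  ultimately show ?thesis by (simp add: inner_linear_axis[where L = "\<lambda>k. f'' (unstack y) (unstack h) (unstack k) $ i"])
qed

text \<open>The \<open>Sup\<close> in \<open>curvature\<close> is only meaningful for a set bounded
  above. Here \<open>f''\<close> is bounded on \<open>P\<close> by continuity and compactness, and
  the directions lie in a bounded box.\<close>

lemma bdd_above_hessian_form:
  assumes "compact P"
  shows "bdd_above {\<bar>h \<bullet> (hessian (\<lambda>y. f (unstack y) $ i) (stack x u) *v h)\<bar> | x u h.
     (x, u) \<in> P \<and> infnorm h \<le> 1}"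
proof -
  have "bounded (f'' ` P)"
    using assms cont_f'' by (meson compact_continuous_image compact_imp_bounded continuous_on_subset top_greatest)
  then obtain C where C: "\<And>p. p \<in> P \<Longrightarrow> norm (f'' p) \<le> C" by (auto simp: bounded_iff)
  obtain K where "K > 0" and K: "\<And>h :: real ^ ('x + 'u). norm (unstack h) \<le> K * norm h"
    using linear_bounded_pos[OF linear_unstack] by blast
  \<comment> \<open>Compares the Euclidean norm, which governs the operator norms, with the infinity
    norm.\<close>
  let ?s = "sqrt (real DIM(real ^ ('x + 'u)))"
  have "\<bar>h \<bullet> (hessian (\<lambda>y. f (unstack y) $ i) (stack x u) *v h)\<bar> \<le> C * (K * ?s) * (K * ?s)"
    if xu: "(x, u) \<in> P" and h: "infnorm h \<le> 1" for x u h
  proof -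
    have "norm h \<le> ?s * infnorm h" by (rule norm_le_infnorm)
    also have "\<dots> \<le> ?s * 1" using h by (intro mult_left_mono) auto
    finally have "norm (unstack h) \<le> K * ?s"
      using K[of h] \<open>K > 0\<close> by (simp add: order_trans[OF _ mult_left_mono])
    have "C \<ge> 0" using C[OF xu] norm_ge_zero order_trans by blast
    have "\<bar>h \<bullet> (hessian (\<lambda>y. f (unstack y) $ i) (stack x u) *v h)\<bar>
        \<le> norm (f'' (x, u) (unstack h) (unstack h))"
      unfolding hessian_quadratic_form unstack_stack by (rule component_le_norm_cart)
    also have "\<dots> \<le> norm (f'' (x, u) (unstack h)) * norm (unstack h)" by (rule norm_blinfun)
    also have "\<dots> \<le> (norm (f'' (x, u)) * norm (unstack h)) * norm (unstack h)"
      by (intro mult_right_mono norm_blinfun) simp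
    also have "\<dots> \<le> C * (K * ?s) * (K * ?s)"
      using C[OF xu] \<open>norm (unstack h) \<le> K * ?s\<close> \<open>C \<ge> 0\<close> \<open>K > 0\<close> by (intro mult_mono) auto
    finally show ?thesis .
  qed
  then show ?thesis by (intro bdd_aboveI) auto
qed

text \<open>A nonzero direction is rescaled to infinity norm 1, where the supremum applies;
  bilinearity returns the square of the scale. The factor 2 cancels the 1/2 in
  \<open>curvature\<close>.\<close>

lemma second_derivative_le_curvature:
  assumes "compact P" and q: "q \<in> P"
  shows "\<bar>f'' q d d $ i\<bar> \<le> 2 * curvature f P i * (infnorm (stack (fst d) (snd d)))\<^sup>2"
proof -
  define h where "h = stack (fst d) (snd d)"
  have d: "d = unstack h" by (simp add: h_def)
  show ?thesis
  proof (cases "infnorm h = 0")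
    case True
    then have "d = 0" using linear_0[OF linear_unstack] by (simp add: d infnorm_eq_0)
    then show ?thesis by (simp add: blinfun.zero_right stack_zero infnorm_0)
  next
    case False
    then have pos: "infnorm h > 0" using infnorm_pos_le[of h] by linarith
    define e where "e = (1 / infnorm h) *\<^sub>R h"
    have h: "h = infnorm h *\<^sub>R e" using pos by (simp add: e_def)
    have "infnorm e \<le> 1" using pos by (simp add: e_def infnorm_mul)
    then have "\<bar>e \<bullet> (hessian (\<lambda>y. f (unstack y) $ i) (stack (fst q) (snd q)) *v e)\<bar>
        \<le> 2 * curvature f P i"
      unfolding curvature_def
      using cSup_upper[OF _ bdd_above_hessian_form[OF assms(1)], of _ i] q
      by (simp, metis (mono_tags, lifting) prod.collapse mem_Collect_eq)
    then have "\<bar>f'' q (unstack e) (unstack e) $ i\<bar> \<le> 2 * curvature f P i"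
      by (simp add: hessian_quadratic_form)
    moreover have "d = infnorm h *\<^sub>R unstack e"
      using h linear_cmul[OF linear_unstack] by (metis d)
    then have "\<bar>f'' q d d $ i\<bar> = \<bar>f'' q (unstack e) (unstack e) $ i\<bar> * (infnorm h)\<^sup>2"
      using pos
      by (simp add: blinfun.scaleR_right blinfun.scaleR_left abs_mult power2_eq_square)
    ultimately show ?thesis
      unfolding h_def[symmetric] by (simp add: mult_right_mono)
  qed
qed

text \<open>The direction 0 contributes the value 0 to the supremum. Nonemptiness of
  \<open>P\<close> supplies a base point, as the \<open>Sup\<close> of an empty set is
  unspecified.\<close>

lemma curvature_nonneg:
  assumes "compact P" "P \<noteq> {}"
  shows "0 \<le> curvature f P i"
proof -
  obtain q where q: "q \<in> P" using assms by blast
  define h :: "real ^ ('x + 'u)" where "h = 0"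
  have "0 \<le> Sup {\<bar>h \<bullet> (hessian (\<lambda>y. f (unstack y) $ i) (stack x u) *v h)\<bar> | x u h.
     (x, u) \<in> P \<and> infnorm h \<le> 1}"
    using q
    by (intro cSup_upper2[OF _ _ bdd_above_hessian_form[OF assms(1)]])
      (auto intro!: exI[of _ "fst q"] exI[of _ "snd q"] exI[of _ h] simp: h_def infnorm_0)
  then show ?thesis by (simp add: curvature_def)
qed

text \<open>Taylor's formula with Lagrange remainder for one component along the segment from
  \<open>(z, v)\<close> to \<open>(x, u)\<close>. Convexity keeps the intermediate point in
  \<open>P\<close>, where the curvature bounds the second derivative.\<close>

lemma linearization_error:
  assumes "compact P" "convex P" "(z, v) \<in> P" "(x, u) \<in> P"
  shows "\<bar>(f (x, u) - f (z, v) - jac_x f z v *v (x - z) - jac_u f z v *v (u - v)) $ i\<bar>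
       \<le> curvature f P i * (infnorm (stack (x - z) (u - v)))\<^sup>2"
proof -
  define p where "p = (z, v)"
  define d where "d = (x - z, u - v)"
  \<comment> \<open>The scalar function \<open>t -> f (p + t d) $ i\<close> with its first and
    second derivative, packed as the sequence that \<open>Maclaurin\<close> expects.\<close>
  define diff where "diff n t = (if n = 0 then f (p + t *\<^sub>R d) $ i
    else if n = 1 then f' (p + t *\<^sub>R d) d $ i else f'' (p + t *\<^sub>R d) d d $ i)" for n :: nat and t :: real
  have diff: "diff 0 = (\<lambda>t. f (p + t *\<^sub>R d) $ i)" "diff 1 = (\<lambda>t. f' (p + t *\<^sub>R d) d $ i)"
    "diff 2 = (\<lambda>t. f'' (p + t *\<^sub>R d) d d $ i)"
    by (simp_all add: diff_def fun_eq_iff)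
  have line: "((\<lambda>t. p + t *\<^sub>R d) has_derivative (\<lambda>t. t *\<^sub>R d)) (at t)" for t :: real
    by (auto intro!: derivative_eq_intros)
  have "((\<lambda>t. f (p + t *\<^sub>R d) $ i) has_derivative (\<lambda>s. f' (p + t *\<^sub>R d) (s *\<^sub>R d) $ i)) (at t)" for t
    using bounded_linear.has_derivative[OF bounded_linear_vec_nth diff_chain_at[OF line f'], of i]
    by (simp add: comp_def)
  then have D0: "DERIV (diff 0) t :> diff 1 t" for t
    unfolding diff by (simp add: has_field_derivative_def blinfun.scaleR_right mult.commute[of _ "_ $ _"])
  have "((\<lambda>t. f' (p + t *\<^sub>R d) d $ i) has_derivative (\<lambda>s. f'' (p + t *\<^sub>R d) (s *\<^sub>R d) d $ i)) (at t)" for t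
    using diff_chain_at[OF line f'_apply_has_derivative] by (simp add: comp_def)
  then have D1: "DERIV (diff 1) t :> diff 2 t" for t
    unfolding diff by (simp add: has_field_derivative_def blinfun.scaleR_right blinfun.scaleR_left
        mult.commute[of _ "_ $ _"])
  have "\<exists>t. 0 < t \<and> t < 1 \<and>
      diff 0 1 = (\<Sum>m<2. diff m 0 / fact m * 1 ^ m) + diff 2 t / fact 2 * 1 ^ 2"
    using D0 D1 by (intro Maclaurin) (auto simp: numeral_2_eq_2 less_Suc_eq)
  then obtain t where t: "0 < t" "t < 1" and eq: "diff 0 1 = diff 0 0 + diff 1 0 + diff 2 t / 2"
    by (auto simp: numeral_2_eq_2)
  have "p + t *\<^sub>R d = (1 - t) *\<^sub>R (z, v) + t *\<^sub>R (x, u)"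
    by (simp add: p_def d_def algebra_simps)
  then have "p + t *\<^sub>R d \<in> P"
    using convexD_alt[OF assms(2-4), of t] t by simp
  then have "\<bar>diff 2 t\<bar> \<le> 2 * curvature f P i * (infnorm (stack (x - z) (u - v)))\<^sup>2"
    using second_derivative_le_curvature[OF assms(1), of "p + t *\<^sub>R d" d i]
    by (simp add: diff d_def)
  moreover have "jac_x f z v *v (x - z) + jac_u f z v *v (u - v) = f' p d"
    unfolding p_def d_def by (rule jac_partial_derivatives[OF f'])
  then have "f (x, u) - f (z, v) - jac_x f z v *v (x - z) - jac_u f z v *v (u - v)
      = f (x, u) - f (z, v) - f' p d"
    by (metis diff_diff_eq)
  then have "(f (x, u) - f (z, v) - jac_x f z v *v (x - z) - jac_u f z v *v (u - v)) $ i = diff 2 t / 2"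
    using eq unfolding diff by (simp only:) (simp add: p_def d_def)
  ultimately show ?thesis by simp
qed

end
section \<open>Closed-loop error\<close>

lemma convex_polytope_set:
  fixes c :: "nat \<Rightarrow> real ^ ('x::finite + 'u::finite)"
  shows "convex (polytope_set m c b)"
proof (rule convexI)
  fix p q :: "(real ^ 'x) \<times> (real ^ 'u)" and s t :: real
  assume pq: "p \<in> polytope_set m c b" "q \<in> polytope_set m c b"
    and st: "0 \<le> s" "0 \<le> t" "s + t = 1"
  have stack: "stack (s *\<^sub>R fst p + t *\<^sub>R fst q) (s *\<^sub>R snd p + t *\<^sub>R snd q)
      = s *\<^sub>R stack (fst p) (snd p) + t *\<^sub>R stack (fst q) (snd q)"
    by (rule vec_sum_eqI) simp_all
  have "c i \<bullet> stack (s *\<^sub>R fst p + t *\<^sub>R fst q) (s *\<^sub>R snd p + t *\<^sub>R snd q) + b i \<le> 0"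
    if "i < m" for i
  proof -
    \<comment> \<open>Writing the offset as \<open>(s + t) * b i\<close> makes the affine constraint
      split into a convex combination.\<close>
    have "c i \<bullet> stack (s *\<^sub>R fst p + t *\<^sub>R fst q) (s *\<^sub>R snd p + t *\<^sub>R snd q) + (s + t) * b i
      = s * (c i \<bullet> stack (fst p) (snd p) + b i) + t * (c i \<bullet> stack (fst q) (snd q) + b i)"
      unfolding stack by (simp add: inner_add_right algebra_simps)
    also have "\<dots> \<le> 0"
      using pq that st
      by (intro add_nonpos_nonpos[OF mult_nonneg_nonpos mult_nonneg_nonpos]) (auto simp: polytope_set_def)
    finally show ?thesis using st by simp
  qed
  then show "s *\<^sub>R p + t *\<^sub>R q \<in> polytope_set m c b"
    by (cases p; cases q) (simp add: polytope_set_def)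
qed

text \<open>The remainder lies in a box with half-widths \<open>t^2 * d i\<close>, so it is the
  image of a point of the unit box under the scaled diagonal matrix. Stacked with the generator of
  \<open>w\<close>, this point stays in the unit box.\<close>

lemma disturbance_plus_remainder:
  fixes E :: "real ^ 'w ^ 'x"
  assumes "w \<in> disturbance_set E" and "\<And>i. 0 \<le> d i" and r: "\<And>i. \<bar>r $ i\<bar> \<le> d i * t\<^sup>2"
  obtains \<delta> where "infnorm \<delta> \<le> 1" "w + r = hcat E (t\<^sup>2 *\<^sub>R diag_mat d) *v \<delta>"
proof -
  obtain a where a: "infnorm a \<le> 1" "w = E *v a"
    using assms(1) by (auto simp: disturbance_set_def)
  \<comment> \<open>If \<open>t\<^sup>2 * d i = 0\<close>, then \<open>r $ i = 0\<close> and the junk quotient \<open>0\<close> is the right value.\<close>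
  define e where "e = (\<chi> i. r $ i / (t\<^sup>2 * d i))"
  have "\<bar>e $ i\<bar> \<le> 1" for i
    using r[of i] assms(2)[of i]
    by (cases "t\<^sup>2 * d i = 0") (auto simp: e_def abs_mult divide_le_eq_1 mult.commute zero_less_mult_iff)
  then have "infnorm (stack a e) \<le> 1"
    using a(1) by (simp add: infnorm_stack_le_iff) (simp add: infnorm_le_iff_cart)
  moreover have "r $ i = t\<^sup>2 * d i * e $ i" for i
    using r[of i] by (cases "t\<^sup>2 * d i = 0") (auto simp: e_def)
  then have "(t\<^sup>2 *\<^sub>R diag_mat d) *v e = r"
    by (simp add: vec_eq_iff matrix_vector_mult_def diag_mat_def if_distrib[of "\<lambda>x. x * _"]
        if_distrib[of "\<lambda>x. _ * x"] cong: if_cong)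
  ultimately show ?thesis
    using that[of "stack a e"] a(2) by (simp add: hcat_mult_vec)
qed

text \<open>At position \<open>(i, i)\<close> the recursion refers only to blocks of row
  \<open>i - 1\<close> in column \<open>i\<close>, which lie above the diagonal and vanish.\<close>

lemma sls_diagonal:
  assumes "blk_eq T (sls_lhs T f z v \<Phi>x \<Phi>u) blk_one"
    and "\<Phi>x \<in> blk_lower T" "\<Phi>u \<in> blk_lower T" and i: "i < T"
  shows "\<Phi>x i i = mat 1"
  using sls_recursion[OF assms(1) i i] assms(2,3) i
  by (cases i) (auto simp: blk_lower_def blk_one_def blk_diag_def)

text \<open>Block row \<open>i\<close> produces the input at time \<open>i + 1\<close> and column
  \<open>j\<close> reads the state at time \<open>j + 1\<close>, so the vanishing blocks
  \<open>j > i\<close> are exactly those that would read the future.\<close>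

lemma causal_error_feedback:
  fixes K :: "('u::finite, 'x::finite) blocks"
  assumes "K \<in> blk_lower T"
  shows "causal T (error_feedback T K z v)"
  unfolding causal_def
proof (intro allI impI)
  fix k and x y :: "nat \<Rightarrow> real ^ 'x" assume k: "k \<le> T" and eq: "\<forall>j\<le>k. x j = y j"
  show "error_feedback T K z v x k = error_feedback T K z v y k"
  proof (cases k)
    case (Suc i)
    have "K i j *v (x (Suc j) - z (Suc j)) = K i j *v (y (Suc j) - z (Suc j))" if "j < T" for j
    proof (cases "i < j")
      case True
      then have "K i j = 0" using assms that k Suc by (auto simp: blk_lower_def)
      then show ?thesis by simp
    next
      case False
      then have "x (Suc j) = y (Suc j)" using eq Suc by auto
      then show ?thesis by simp
    qed
    then show ?thesis by (simp add: Suc error_feedback_def)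
  qed (simp add: error_feedback_def)
qed

text \<open>In the coordinates \<open>y\<close> with \<open>dx = \<Phi>x y\<close> and \<open>du = \<Phi>u y\<close>, the system level constraint says
  exactly that \<open>y\<close> is the one-step error of the linearized dynamics.\<close>

lemma sls_response:
  assumes sls: "blk_eq T (sls_lhs T f z v \<Phi>x \<Phi>u) blk_one"
    and dx: "\<And>i. i < T \<Longrightarrow> dx (Suc i) = (\<Sum>l<T. \<Phi>x i l *v y l)"
    and du: "\<And>i. i < T \<Longrightarrow> du (Suc i) = (\<Sum>l<T. \<Phi>u i l *v y l)"
    and zero: "dx 0 = 0" "du 0 = 0" and i: "i < T"
  shows "y i = dx (Suc i) - jac_x f (z i) (v i) *v dx i - jac_u f (z i) (v i) *v du i"
proof -
  have one: "(\<Sum>l<T. blk_one i l *v y l) = y i"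
    using i by (simp add: blk_one_def blk_diag_def if_distrib[of "\<lambda>M. M *v _"] sum.delta' cong: if_cong)
  show ?thesis
  proof (cases i)
    case 0
    \<comment> \<open>The initial deviations are zero, so at time 0 the Jacobian terms drop
      out.\<close>
    have "dx (Suc i) = (\<Sum>l<T. blk_one i l *v y l)"
      unfolding dx[OF i] using sls_recursion[OF sls i] 0 by (intro sum.cong) simp_all
    then show ?thesis unfolding one by (simp add: 0 zero)
  next
    case (Suc k)
    let ?A = "jac_x f (z i) (v i)" and ?B = "jac_u f (z i) (v i)"
    have "dx (Suc i) = (\<Sum>l<T. blk_one i l *v y l + (?A *v (\<Phi>x k l *v y l) + ?B *v (\<Phi>u k l *v y l)))"
      unfolding dx[OF i] using sls_recursion[OF sls i] Suc
      by (intro sum.cong) (simp_all add: matrix_vector_mult_add_rdistrib matrix_vector_mul_assoc)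
    also have "\<dots> = y i + (?A *v dx i + ?B *v du i)"
      using dx[of k] du[of k] i Suc
      by (simp add: sum.distrib one[unfolded Suc] matrix_vector_mult_sum_right)
    finally show ?thesis by simp
  qed
qed

text \<open>Invertibility of \<open>\<Phi>x\<close> is part of the conclusion because
  \<open>blk_inv\<close> is a \<open>SOME\<close> choice, which is an inverse only if one
  exists.\<close>

theorem mainTheorem1:
  fixes T m :: nat
    and xbar :: "real ^ 'x"
    and f :: "(real ^ 'x) \<times> (real ^ 'u) \<Rightarrow> real ^ 'x"
    and c :: "nat \<Rightarrow> real ^ ('x + 'u)" and b :: "nat \<Rightarrow> real"
    and P :: "((real ^ 'x) \<times> (real ^ 'u)) set"
    and E :: "real ^ 'w ^ 'x"
    and \<mu> :: "real ^ 'x ^ 'x"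
    and z :: "nat \<Rightarrow> real ^ 'x" and v :: "nat \<Rightarrow> real ^ 'u"
    and \<Phi>x :: "('x, 'x) blocks" and \<Phi>u :: "('u, 'x) blocks"
    and \<tau> :: "nat \<Rightarrow> real"
    and \<pi> :: "('x, 'u) policy"
  defines "P \<equiv> polytope_set m c b"
    and "\<mu> \<equiv> curvature_matrix f P"
    and "\<pi> \<equiv> error_feedback T (feedback_gain T \<Phi>x \<Phi>u) z v"
  assumes "T \<ge> 1"
    and "twice_continuously_differentiable f"
    and "compact P"
    and "\<Phi>x \<in> blk_lower T" and "\<Phi>u \<in> blk_lower T"
    and "z 0 = xbar"
    and "blk_eq T (sls_lhs T f z v \<Phi>x \<Phi>u) blk_one"
    and "\<forall>k<T. z (Suc k) = f (z k, v k)"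
    and "\<forall>k\<le>T. \<forall>i<m.
           (\<Sum>j<k. norm_one (c i v* (stacked_sub_block \<Phi>x \<Phi>u (k - 1) j **
                                     hcat E ((\<tau> (k - 1 - j))\<^sup>2 *\<^sub>R \<mu>))))
           + c i \<bullet> stack (z k) (v k) + b i \<le> 0"
    and "\<forall>k<T.
           (\<Sum>j<k. mat_infnorm (stacked_sub_block \<Phi>x \<Phi>u (k - 1) j **
                                hcat E ((\<tau> (k - 1 - j))\<^sup>2 *\<^sub>R \<mu>))) \<le> \<tau> k"
  shows "blk_invertible T \<Phi>x \<and> causal T \<pi> \<and>
         (\<forall>w. (\<forall>k<T. w k \<in> disturbance_set E) \<longrightarrow>
            (\<forall>x u. closed_loop T f \<pi> xbar w x u \<longrightarrow> (\<forall>k\<le>T. (x k, u k) \<in> P)))"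
proof -
  note sls = assms(10) and lower = assms(7,8)
  define K where "K = feedback_gain T \<Phi>x \<Phi>u"
  have diag: "\<Phi>x i i = mat 1" if "i < T" for i
    using sls_diagonal[OF sls lower that] .
  have inv: "blk_invertible T \<Phi>x" by (rule blk_lower_invertible[OF lower(1) diag])
  note inverts = blk_inverts_blk_inv[OF inv, unfolded blk_inverts_def]
  have "blk_inv T \<Phi>x \<in> blk_lower T"
    using blk_lower_right_inverse(1)[OF lower(1) diag] inverts by blast
  then have "K \<in> blk_lower T"
    unfolding K_def feedback_gain_def by (rule blk_lower_mult[OF lower(2)])
  then have causal: "causal T \<pi>" unfolding \<pi>_def K_def by (rule causal_error_feedback)
  \<comment> \<open>The tightening in condition 3 is nonnegative, so the nominal trajectory is
    feasible. This puts the expansion point of Taylor's formula into \<open>P\<close>.\<close>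
  have nominal: "(z k, v k) \<in> P" if "k \<le> T" for k
  proof -
    have "c i \<bullet> stack (z k) (v k) + b i \<le> 0" if "i < m" for i
    proof -
      have "0 \<le> (\<Sum>j<k. norm_one (c i v* (stacked_sub_block \<Phi>x \<Phi>u (k - 1) j **
                                     hcat E ((\<tau> (k - 1 - j))\<^sup>2 *\<^sub>R \<mu>))))"
        by (intro sum_nonneg norm_one_nonneg)
      then show ?thesis using assms(12) \<open>k \<le> T\<close> that by fastforce
    qed
    then show ?thesis by (simp add: P_def polytope_set_def)
  qed
  obtain f' f'' where "C2_map f f' f''"
    using assms(5) unfolding twice_continuously_differentiable_def C2_map_def by blast
  then interpret C2_map f f' f'' .
  have robust: "(x k, u k) \<in> P"
    if w: "\<forall>k<T. w k \<in> disturbance_set E" and cl: "closed_loop T f \<pi> xbar w x u" and "k \<le> T"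
    for w x u k
  proof -
    define dx where "dx k = x k - z k" for k
    define du where "du k = u k - v k" for k
    \<comment> \<open>Index \<open>i\<close> of \<open>y\<close> is paired with the deviation at
      time \<open>i + 1\<close>, the first one that \<open>w i\<close> affects.\<close>
    define y where "y i = (\<Sum>j<T. blk_inv T \<Phi>x i j *v dx (Suc j))" for i
    have zero: "dx 0 = 0" "du 0 = 0"
      using cl assms(9) by (simp_all add: dx_def du_def closed_loop_def \<pi>_def error_feedback_def)
    have dx: "dx (Suc i) = (\<Sum>l<T. \<Phi>x i l *v y l)" if "i < T" for i
    proof -
      have "(\<Sum>l<T. \<Phi>x i l *v y l) = (\<Sum>j<T. blk_mult T \<Phi>x (blk_inv T \<Phi>x) i j *v dx (Suc j))"
        unfolding y_def blk_mult_vec ..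
      also have "\<dots> = (\<Sum>j<T. if i = j then dx (Suc j) else 0)"
        using inverts that by (intro sum.cong) (auto simp: blk_eq_def blk_one_def blk_diag_def)
      finally show ?thesis using that by simp
    qed
    have du: "du (Suc i) = (\<Sum>l<T. \<Phi>u i l *v y l)" if "i < T" for i
    proof -
      have "u (Suc i) = \<pi> x (Suc i)" using cl that by (simp add: closed_loop_def)
      then have "du (Suc i) = (\<Sum>j<T. K i j *v dx (Suc j))"
        by (simp add: du_def \<pi>_def error_feedback_def K_def dx_def)
      then show ?thesis unfolding K_def feedback_gain_def y_def blk_mult_vec .
    qed
    have y: "y i = dx (Suc i) - jac_x f (z i) (v i) *v dx i - jac_u f (z i) (v i) *v du i"
      if "i < T" for i
      by (rule sls_response[where dx = dx and du = du and y = y, OF sls])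
        (use that in \<open>simp_all add: dx du zero\<close>)
    have response: "stack (dx k) (du k) = (\<Sum>j<k. stacked_sub_block \<Phi>x \<Phi>u (k - 1) j *v y (k - 1 - j))"
      if "k \<le> T" for k
    proof (cases k)
      case (Suc i)
      then have i: "i < T" using that by simp
      have "stack (dx k) (du k) = (\<Sum>l<T. stack (\<Phi>x i l) (\<Phi>u i l) *v y l)"
        unfolding Suc dx[OF i] du[OF i] stack_sum stack_mult_vec ..
      \<comment> \<open>Only blocks up to the diagonal contribute. Reversing the sum then gives the
        leftward indexing of \<open>sub_block\<close>, where block \<open>j\<close> acts on
        \<open>y (k - 1 - j)\<close>.\<close>
      also have "\<dots> = (\<Sum>l<k. stack (\<Phi>x i l) (\<Phi>u i l) *v y l)"
        using lower i Suc
        by (intro sum.mono_neutral_right) (auto simp: blk_lower_def stack_zero)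
      also have "\<dots> = (\<Sum>j<k. stack (\<Phi>x i (k - Suc j)) (\<Phi>u i (k - Suc j)) *v y (k - Suc j))"
        by (rule sum.nat_diff_reindex[symmetric])
      finally show ?thesis by (simp add: stacked_sub_block_def sub_block_def Suc)
    qed (simp add: zero stack_zero)
    \<comment> \<open>Strong induction, since the deviation at time \<open>k\<close> depends on all
      earlier \<open>y l\<close>. The bound by \<open>\<tau>\<close> is carried along for
      \<open>k < T\<close>, the range of condition 4, and feeds the remainder estimates at later
      times.\<close>
    have "(x k, u k) \<in> P \<and> (k < T \<longrightarrow> infnorm (stack (dx k) (du k)) \<le> \<tau> k)" if "k \<le> T" for k
      using that
    proof (induction k rule: less_induct)
      case (less k)
      have "\<exists>\<delta>. infnorm \<delta> \<le> 1 \<and> y l = hcat E ((\<tau> l)\<^sup>2 *\<^sub>R \<mu>) *v \<delta>" if "l < k" for l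
      proof -
        have l: "l < T" and IH: "(x l, u l) \<in> P" "infnorm (stack (dx l) (du l)) \<le> \<tau> l"
          using less that by auto
        have zl: "(z l, v l) \<in> P" using nominal l by simp
        define r where "r = f (x l, u l) - f (z l, v l)
          - jac_x f (z l) (v l) *v (x l - z l) - jac_u f (z l) (v l) *v (u l - v l)"
        have "\<bar>r $ i\<bar> \<le> curvature f P i * (\<tau> l)\<^sup>2" for i
        proof -
          have "\<bar>r $ i\<bar> \<le> curvature f P i * (infnorm (stack (dx l) (du l)))\<^sup>2"
            unfolding r_def dx_def du_def using assms(6) convex_polytope_set zl IH(1)
            by (intro linearization_error) (auto simp: P_def)
          also have "\<dots> \<le> curvature f P i * (\<tau> l)\<^sup>2"
            using IH zl
            by (intro mult_left_mono power_mono curvature_nonneg assms(6)) (auto simp: infnorm_pos_le)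
          finally show ?thesis .
        qed
        moreover have "w l \<in> disturbance_set E" using w l by blast
        moreover have "0 \<le> curvature f P i" for i using zl assms(6) by (intro curvature_nonneg) auto
        ultimately obtain \<delta> where \<delta>: "infnorm \<delta> \<le> 1" "w l + r = hcat E ((\<tau> l)\<^sup>2 *\<^sub>R \<mu>) *v \<delta>"
          unfolding \<mu>_def curvature_matrix_def using disturbance_plus_remainder by metis
        have "x (Suc l) = f (x l, u l) + w l" "z (Suc l) = f (z l, v l)"
          using cl l assms(11) by (auto simp: closed_loop_def)
        \<comment> \<open>Subtracting the nominal dynamics from the closed loop leaves the
          disturbance and the Taylor remainder once the linear part is removed.\<close>
        then have "y l = w l + r"
          unfolding y[OF l] r_def by (simp add: dx_def du_def)
        with \<delta> show ?thesis by auto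
      qed
      then obtain \<delta> where \<delta>: "\<And>l. l < k \<Longrightarrow> infnorm (\<delta> l) \<le> 1"
        "\<And>l. l < k \<Longrightarrow> y l = hcat E ((\<tau> l)\<^sup>2 *\<^sub>R \<mu>) *v \<delta> l"
        by metis
      let ?M = "\<lambda>j. stacked_sub_block \<Phi>x \<Phi>u (k - 1) j ** hcat E ((\<tau> (k - 1 - j))\<^sup>2 *\<^sub>R \<mu>)"
      \<comment> \<open>The deviation is now a sum of linear images of unit-box vectors; the
        matrices \<open>?M j\<close> are those of conditions 3 and 4.\<close>
      have err: "stack (dx k) (du k) = (\<Sum>j<k. ?M j *v \<delta> (k - 1 - j))"
        unfolding response[OF less.prems]
        by (rule sum.cong) (auto simp: \<delta>(2) matrix_vector_mul_assoc)
      have "c i \<bullet> stack (x k) (u k) + b i \<le> 0" if "i < m" for i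
      proof -
        have "c i \<bullet> stack (dx k) (du k) = (\<Sum>j<k. (c i v* ?M j) \<bullet> \<delta> (k - 1 - j))"
          by (simp add: err inner_sum_right dot_lmul_matrix)
        also have "\<dots> \<le> (\<Sum>j<k. norm_one (c i v* ?M j))"
          by (intro sum_mono inner_le_norm_one \<delta>(1)) auto
        finally have "c i \<bullet> stack (dx k) (du k) + c i \<bullet> stack (z k) (v k) + b i \<le> 0"
          using assms(12) less.prems that by force
        then show ?thesis by (simp add: dx_def du_def stack_diff inner_diff_right)
      qed
      then have "(x k, u k) \<in> P" by (simp add: P_def polytope_set_def)
      moreover have "infnorm (stack (dx k) (du k)) \<le> \<tau> k" if "k < T"
      proof -
        have "infnorm (stack (dx k) (du k)) \<le> (\<Sum>j<k. infnorm (?M j *v \<delta> (k - 1 - j)))"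
          unfolding err by (rule infnorm_sum_le)
        also have "\<dots> \<le> (\<Sum>j<k. mat_infnorm (?M j))"
          by (intro sum_mono infnorm_le_mat_infnorm \<delta>(1)) auto
        also have "\<dots> \<le> \<tau> k" using assms(13) that by blast
        finally show ?thesis .
      qed
      ultimately show ?case by blast
    qed
    with \<open>k \<le> T\<close> show ?thesis by blast
  qed
  show ?thesis using inv causal robust by blast
qed

end
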